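(* Let $\Omega\subset \mathbb{C}$ be a finitely connected domain that is not simply connected, and let $N\ge 2$. Then there are no injective holomorphic self-maps $\phi_1,\dots,\phi_N$ of $\Omega$ such that the composition operators $C_{\phi_1},\dots,C_{\phi_N}$ on $H(\Omega)$ are disjoint topologically transitive.
   Context: $\mathbb{N}$ denotes the set of positive integers and $\hat{\mathbb{C}}=\mathbb{C}\cup\{\infty\}$. A domain is a non-empty connected open subset $\Omega$ of $\mathbb{C}$; it is simply connected if $\hat{\mathbb{C}}\setminus\Omega$ is connected, and finitely connected if $\hat{\mathbb{C}}\setminus\Omega$ has at most finitely many connected components. $H(\Omega)$ is the space of holomorphic functions on $\Omega$ with the topology of uniform convergence on compact subsets. For a holomorphic self-map $\phi$ of $\Omega$, $C_\phi(f)=f\circ\phi$ for $f\in H(\Omega)$. Continuous linear operators $T_1,\dots,T_N$ ($N\ge2$) on a topological vector space $X$ are disjoint topologically transitive if for all non-empty open subsets $U_0,\dots,U_N$ of $X$ there exists $n\in\mathbb{N}$ such that $U_0\cap T_1^{-n}(U_1)\cap\dots\cap T_N^{-n}(U_N)\neq\emptyset$, where $T_i^{-n}(U_i)$ is the preimage of $U_i$ under $T_i^n$. *)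

theory Defs
  imports "HOL-Complex_Analysis.Complex_Analysis"
begin

definition domain_in_plane :: "complex set \<Rightarrow> bool" where
  "domain_in_plane \<Omega> \<longleftrightarrow> \<Omega> \<noteq> {} \<and> open \<Omega> \<and> connected \<Omega>"

text \<open>The extended plane is the one-point compactification of the complex plane: finite points
  are \<open>Some z\<close>, and \<open>None\<close> is the point at infinity.\<close>

definition extended_plane :: "complex option topology" where
  "extended_plane = Alexandroff_compactification euclidean"

definition extended_complement :: "complex set \<Rightarrow> complex option set" where
  "extended_complement \<Omega> = topspace extended_plane - Some ` \<Omega>"

text \<open>The library constant \<open>simply_connected\<close> is the homotopic notion; here simple
  connectivity is connectedness of the complement in the extended plane.\<close>

definition simply_connected_domain :: "complex set \<Rightarrow> bool" where
  "simply_connected_domain \<Omega> \<longleftrightarrow>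
     domain_in_plane \<Omega> \<and> connectedin extended_plane (extended_complement \<Omega>)"

definition finitely_connected_domain :: "complex set \<Rightarrow> bool" where
  "finitely_connected_domain \<Omega> \<longleftrightarrow>
     domain_in_plane \<Omega> \<and>
     finite (connected_components_of (subtopology extended_plane (extended_complement \<Omega>)))"

text \<open>A holomorphic function on \<open>\<Omega>\<close> is represented by the unique total function that agrees
  with it on \<open>\<Omega>\<close> and is \<open>undefined\<close> elsewhere.\<close>

definition hol_fun :: "complex set \<Rightarrow> (complex \<Rightarrow> complex) set" where
  "hol_fun \<Omega> = {f. f holomorphic_on \<Omega> \<and> f \<in> extensional \<Omega>}"

definition hol_nbhd ::
  "complex set \<Rightarrow> (complex \<Rightarrow> complex) \<Rightarrow> complex set \<Rightarrow> real \<Rightarrow> (complex \<Rightarrow> complex) set" where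
  "hol_nbhd \<Omega> f K e = {g \<in> hol_fun \<Omega>. \<forall>z\<in>K. dist (g z) (f z) < e}"

text \<open>The topology of uniform convergence on compact subsets of \<open>\<Omega>\<close>.\<close>

definition hol_open :: "complex set \<Rightarrow> (complex \<Rightarrow> complex) set \<Rightarrow> bool" where
  "hol_open \<Omega> U \<longleftrightarrow>
     U \<subseteq> hol_fun \<Omega> \<and>
     (\<forall>f\<in>U. \<exists>K e. compact K \<and> K \<subseteq> \<Omega> \<and> e > 0 \<and> hol_nbhd \<Omega> f K e \<subseteq> U)"

definition hol_space :: "complex set \<Rightarrow> (complex \<Rightarrow> complex) topology" where
  "hol_space \<Omega> = topology (hol_open \<Omega>)"

lemma istopology_hol_open: "istopology (hol_open \<Omega>)"
  unfolding istopology_def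
proof (intro conjI allI impI)
  fix S T assume S: "hol_open \<Omega> S" and T: "hol_open \<Omega> T"
  show "hol_open \<Omega> (S \<inter> T)"
    unfolding hol_open_def
  proof (intro conjI ballI)
    show "S \<inter> T \<subseteq> hol_fun \<Omega>" using S by (auto simp: hol_open_def)
    fix f assume f: "f \<in> S \<inter> T"
    obtain K d where K: "compact K" "K \<subseteq> \<Omega>" "d > 0" "hol_nbhd \<Omega> f K d \<subseteq> S"
      using S f by (auto simp: hol_open_def)
    obtain L e where L: "compact L" "L \<subseteq> \<Omega>" "e > 0" "hol_nbhd \<Omega> f L e \<subseteq> T"
      using T f by (auto simp: hol_open_def)
    have "hol_nbhd \<Omega> f (K \<union> L) (min d e) \<subseteq> hol_nbhd \<Omega> f K d \<inter> hol_nbhd \<Omega> f L e"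
      by (auto simp: hol_nbhd_def)
    then have "hol_nbhd \<Omega> f (K \<union> L) (min d e) \<subseteq> S \<inter> T" using K L by blast
    moreover have "compact (K \<union> L)" "K \<union> L \<subseteq> \<Omega>" "min d e > 0" using K L by auto
    ultimately show "\<exists>K e. compact K \<and> K \<subseteq> \<Omega> \<and> e > 0 \<and> hol_nbhd \<Omega> f K e \<subseteq> S \<inter> T"
      by blast
  qed
next
  fix \<K> assume *: "\<forall>S\<in>\<K>. hol_open \<Omega> S"
  show "hol_open \<Omega> (\<Union>\<K>)"
    unfolding hol_open_def
  proof (intro conjI ballI)
    show "\<Union>\<K> \<subseteq> hol_fun \<Omega>" using * by (simp add: hol_open_def Sup_le_iff)
    fix f assume "f \<in> \<Union>\<K>"
    then obtain S where S: "S \<in> \<K>" "f \<in> S" by (rule UnionE)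
    have "hol_open \<Omega> S" using * S(1) by (rule bspec)
    then obtain K e where "compact K" "K \<subseteq> \<Omega>" "e > 0" "hol_nbhd \<Omega> f K e \<subseteq> S"
      using S(2) unfolding hol_open_def by blast
    moreover have "S \<subseteq> \<Union>\<K>" using S(1) by (rule Union_upper)
    ultimately show "\<exists>K e. compact K \<and> K \<subseteq> \<Omega> \<and> e > 0 \<and> hol_nbhd \<Omega> f K e \<subseteq> \<Union>\<K>"
      by (meson subset_trans)
  qed
qed

lemma openin_hol_space: "openin (hol_space \<Omega>) U \<longleftrightarrow> hol_open \<Omega> U"
  by (simp add: hol_space_def istopology_hol_open)

lemma topspace_hol_space [simp]: "topspace (hol_space \<Omega>) = hol_fun \<Omega>"
proof (rule antisym)
  show "topspace (hol_space \<Omega>) \<subseteq> hol_fun \<Omega>"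
    by (auto simp: topspace_def openin_hol_space hol_open_def)
  have "hol_open \<Omega> (hol_fun \<Omega>)"
    unfolding hol_open_def
  proof (intro conjI ballI)
    fix f
    have "compact ({} :: complex set)" "{} \<subseteq> \<Omega>" "(1::real) > 0" "hol_nbhd \<Omega> f {} 1 \<subseteq> hol_fun \<Omega>"
      by (auto simp: hol_nbhd_def)
    then show "\<exists>K e. compact K \<and> K \<subseteq> \<Omega> \<and> e > 0 \<and> hol_nbhd \<Omega> f K e \<subseteq> hol_fun \<Omega>"
      by blast
  qed simp
  then show "hol_fun \<Omega> \<subseteq> topspace (hol_space \<Omega>)"
    by (auto simp: topspace_def openin_hol_space)
qed

definition comp_op ::
  "complex set \<Rightarrow> (complex \<Rightarrow> complex) \<Rightarrow> (complex \<Rightarrow> complex) \<Rightarrow> (complex \<Rightarrow> complex)" where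
  "comp_op \<Omega> \<phi> f = restrict (f \<circ> \<phi>) \<Omega>"

definition injective_hol_self_map :: "complex set \<Rightarrow> (complex \<Rightarrow> complex) \<Rightarrow> bool" where
  "injective_hol_self_map \<Omega> \<phi> \<longleftrightarrow> \<phi> holomorphic_on \<Omega> \<and> \<phi> ` \<Omega> \<subseteq> \<Omega> \<and> inj_on \<phi> \<Omega>"

lemma comp_op_hol_fun:
  assumes "\<phi> holomorphic_on \<Omega>" "\<phi> ` \<Omega> \<subseteq> \<Omega>" "f \<in> hol_fun \<Omega>"
  shows "comp_op \<Omega> \<phi> f \<in> hol_fun \<Omega>"
proof -
  have "(f \<circ> \<phi>) holomorphic_on \<Omega>"
    using holomorphic_on_compose_gen[OF assms(1) _ assms(2)] assms(3) by (simp add: hol_fun_def)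
  then have "restrict (f \<circ> \<phi>) \<Omega> holomorphic_on \<Omega>"
    by (rule holomorphic_transform) auto
  then show ?thesis by (auto simp: hol_fun_def comp_op_def)
qed

lemma continuous_map_comp_op:
  assumes "\<phi> holomorphic_on \<Omega>" "\<phi> ` \<Omega> \<subseteq> \<Omega>"
  shows "continuous_map (hol_space \<Omega>) (hol_space \<Omega>) (comp_op \<Omega> \<phi>)"
  unfolding continuous_map_def
proof (intro conjI allI impI)
  show "comp_op \<Omega> \<phi> \<in> topspace (hol_space \<Omega>) \<rightarrow> topspace (hol_space \<Omega>)"
    using comp_op_hol_fun[OF assms] by auto
  fix U assume "openin (hol_space \<Omega>) U"
  then have U: "hol_open \<Omega> U" by (simp add: openin_hol_space)
  have "hol_open \<Omega> {f \<in> hol_fun \<Omega>. comp_op \<Omega> \<phi> f \<in> U}"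
    unfolding hol_open_def
  proof (intro conjI ballI)
    fix f assume f: "f \<in> {f \<in> hol_fun \<Omega>. comp_op \<Omega> \<phi> f \<in> U}"
    then obtain K e where K: "compact K" "K \<subseteq> \<Omega>" "e > 0"
        and sub: "hol_nbhd \<Omega> (comp_op \<Omega> \<phi> f) K e \<subseteq> U"
      using U unfolding hol_open_def by blast
    have "continuous_on K \<phi>"
      using assms(1) K(2) holomorphic_on_imp_continuous_on holomorphic_on_subset by blast
    then have 1: "compact (\<phi> ` K)" using K(1) by (rule compact_continuous_image)
    have 2: "\<phi> ` K \<subseteq> \<Omega>" using K(2) assms(2) by blast
    have "comp_op \<Omega> \<phi> g \<in> hol_nbhd \<Omega> (comp_op \<Omega> \<phi> f) K e" if "g \<in> hol_nbhd \<Omega> f (\<phi> ` K) e" for g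
    proof -
      have "g \<in> hol_fun \<Omega>" and *: "\<forall>z\<in>K. dist (g (\<phi> z)) (f (\<phi> z)) < e"
        using that by (auto simp: hol_nbhd_def)
      moreover have "\<forall>z\<in>K. dist (comp_op \<Omega> \<phi> g z) (comp_op \<Omega> \<phi> f z) < e"
        using * K(2) by (auto simp: comp_op_def subset_iff)
      ultimately show ?thesis using comp_op_hol_fun[OF assms] by (simp add: hol_nbhd_def)
    qed
    then have "hol_nbhd \<Omega> f (\<phi> ` K) e \<subseteq> {f \<in> hol_fun \<Omega>. comp_op \<Omega> \<phi> f \<in> U}"
      using sub by (auto simp: hol_nbhd_def)
    then show "\<exists>K e. compact K \<and> K \<subseteq> \<Omega> \<and> e > 0 \<and>
        hol_nbhd \<Omega> f K e \<subseteq> {f \<in> hol_fun \<Omega>. comp_op \<Omega> \<phi> f \<in> U}"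
      using 1 2 K(3) by blast
  qed auto
  then show "openin (hol_space \<Omega>) {f \<in> topspace (hol_space \<Omega>). comp_op \<Omega> \<phi> f \<in> U}"
    by (simp add: openin_hol_space)
qed

text \<open>The operators are \<open>T 1, \<dots>, T N\<close>; other indices are irrelevant. The notion is meant for
  continuous linear operators; linearity and continuity are not repeated here. Composition
  operators are visibly linear, and continuous by \<open>continuous_map_comp_op\<close>.\<close>

definition disjoint_topologically_transitive ::
  "'a topology \<Rightarrow> nat \<Rightarrow> (nat \<Rightarrow> 'a \<Rightarrow> 'a) \<Rightarrow> bool" where
  "disjoint_topologically_transitive X N T \<longleftrightarrow>
     (\<forall>U :: nat \<Rightarrow> 'a set.
        (\<forall>i\<in>{0..N}. openin X (U i) \<and> U i \<noteq> {}) \<longrightarrow>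
        (\<exists>n\<ge>1. U 0 \<inter> (\<Inter>i\<in>{1..N}. {x \<in> topspace X. (T i ^^ n) x \<in> U i}) \<noteq> {}))"

end

theory Submission
  imports Defs
begin

text \<open>Let \<open>\<phi> = \<phi>\<^sub>1\<close>, and let \<open>\<gamma>\<close> be a loop in \<open>\<Omega>\<close> that winds around some \<open>a \<notin> \<Omega>\<close>. The iterates \<open>h = \<phi>\<^sup>n\<close> are injective and omit every
  \<open>b \<notin> \<Omega>\<close>, so by Bloch's theorem \<open>h' / (h - b)\<close> is bounded on compact sets uniformly in \<open>n\<close> and
  \<open>b\<close>. Since \<open>\<Omega>\<close> is finitely connected, the loops \<open>h \<circ> \<gamma>\<close> therefore fall into finitely many
  homology classes. Take \<open>f\<close> close to \<open>0\<close> on representatives of these classes with \<open>f \<circ> h\<close> close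
  to \<open>1\<close> on \<open>\<gamma>\<close>: integrating \<open>f(w) / (w - b)\<close> along \<open>h \<circ> \<gamma>\<close> in two ways shows that \<open>h \<circ> \<gamma>\<close> is
  null-homologous in \<open>\<Omega>\<close>. But then \<open>(f \<circ> h) h'\<close> integrates to \<open>0\<close> along \<open>\<gamma>\<close> for every
  \<open>f \<in> H(\<Omega>)\<close>, whereas the functions \<open>f \<circ> h\<close> are dense in \<open>H(\<Omega>)\<close> and \<open>g = 1 / (h' (z - a))\<close> gives
  \<open>g h'\<close> the integral \<open>2\<pi>i\<close> times the winding number of \<open>\<gamma>\<close> around \<open>a\<close>.\<close>

section \<open>The complement of \<Omega> in the extended plane\<close>

lemma extended_complement_altdef: "extended_complement \<Omega> = insert None (Some ` (- \<Omega>))"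
  by (auto simp: extended_complement_def extended_plane_def)

lemma open_vimage_Some:
  assumes "openin extended_plane E"
  shows "open (Some -` E)"
  using assms continuous_map_Some[of euclidean]
  by (auto simp: extended_plane_def continuous_map_def vimage_def)

lemma bounded_openin_extended_plane_None:
  assumes "openin extended_plane E" "None \<in> E"
  shows "bounded {z. Some z \<notin> E}"
proof -
  obtain C where "compact C" "E = insert None (Some ` (UNIV - C))"
    using assms unfolding extended_plane_def openin_Alexandroff_compactification by auto
  then have "{z. Some z \<notin> E} \<subseteq> C" by auto
  then show ?thesis using \<open>compact C\<close> bounded_subset compact_imp_bounded by blast
qed

text \<open>Connects the homotopic notion with the one of the theorem. The components of the plane
  complement of a simply connected open set are unbounded, whereas an open set containing infinity
  omits only a bounded part of the plane, so no component can be separated from infinity.\<close>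

lemma simply_connected_imp_connectedin_extended_complement:
  assumes "open \<Omega>" "simply_connected \<Omega>"
  shows "connectedin extended_plane (extended_complement \<Omega>)"
proof -
  let ?S = "extended_complement \<Omega>"
  have *: False
    if E: "openin extended_plane E1" "openin extended_plane E2" "?S \<subseteq> E1 \<union> E2"
      "E1 \<inter> E2 \<inter> ?S = {}" "E2 \<inter> ?S \<noteq> {}" and N: "None \<in> E1" for E1 E2
  proof -
    have "None \<notin> E2" using E(4) N by (auto simp: extended_complement_altdef)
    then obtain z where z: "z \<notin> \<Omega>" "Some z \<in> E2"
      using E(5) by (auto simp: extended_complement_altdef)
    \<comment> \<open>Being connected, \<open>K\<close> lies wholly in \<open>E2\<close>; hence it
      misses the neighbourhood \<open>E1\<close> of infinity and is bounded.\<close>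
    define K where "K = connected_component_set (- \<Omega>) z"
    have K: "K \<subseteq> - \<Omega>" "connected K" "z \<in> K" 
      using z by (auto simp: K_def connected_component_subset dest: connected_component_in)
    have sub: "K \<subseteq> Some -` E1 \<union> Some -` E2"
    proof
      fix x assume "x \<in> K"
      then have "Some x \<in> extended_complement \<Omega>" using K(1) by (auto simp: extended_complement_altdef)
      then show "x \<in> Some -` E1 \<union> Some -` E2" using E(3) by auto
    qed
    have disj: "Some -` E1 \<inter> Some -` E2 \<inter> K = {}"
      using K(1) E(4) by (auto simp: extended_complement_altdef)
    have "Some -` E1 \<inter> K = {}"
      using connectedD[OF K(2) open_vimage_Some[OF E(1)] open_vimage_Some[OF E(2)] disj sub] z K(3)
      by auto
    then have "K \<subseteq> {z. Some z \<notin> E1}" by auto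
    then have "bounded K"
      using bounded_openin_extended_plane_None[OF E(1) N] bounded_subset by blast
    moreover have "K \<in> components (- \<Omega>)" using z by (auto simp: K_def components_def)
    ultimately show False
      using assms simply_connected_eq_unbounded_complement_components by blast
  qed
  show ?thesis
    unfolding connectedin
  proof (intro conjI notI)
    show "?S \<subseteq> topspace extended_plane"
      by (auto simp: extended_complement_def)
    assume "\<exists>E1 E2. openin extended_plane E1 \<and> openin extended_plane E2 \<and> ?S \<subseteq> E1 \<union> E2 \<and>
      E1 \<inter> E2 \<inter> ?S = {} \<and> E1 \<inter> ?S \<noteq> {} \<and> E2 \<inter> ?S \<noteq> {}"
    then obtain E1 E2 where E: "openin extended_plane E1" "openin extended_plane E2"
      "?S \<subseteq> E1 \<union> E2" "E1 \<inter> E2 \<inter> ?S = {}" "E1 \<inter> ?S \<noteq> {}" "E2 \<inter> ?S \<noteq> {}" by blast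
    have "None \<in> E1 \<or> None \<in> E2" using E(3) by (auto simp: extended_complement_altdef)
    then show False
    proof
      assume "None \<in> E1" then show False using * E by blast
    next
      assume "None \<in> E2"
      moreover have "?S \<subseteq> E2 \<union> E1" "E2 \<inter> E1 \<inter> ?S = {}" using E by auto
      ultimately show False using * E by blast
    qed
  qed
qed

section \<open>Winding numbers on the extended plane\<close>

text \<open>The value 0 at infinity is the one that the winding number of a loop takes far away from
  it, so the function stays locally constant at infinity.\<close>

definition ext_winding :: "(real \<Rightarrow> complex) \<Rightarrow> complex option \<Rightarrow> complex" where
  "ext_winding \<gamma> x = (case x of None \<Rightarrow> 0 | Some z \<Rightarrow> winding_number \<gamma> z)"

lemma ext_winding_simps [simp]:
  "ext_winding \<gamma> None = 0" "ext_winding \<gamma> (Some z) = winding_number \<gamma> z"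
  by (simp_all add: ext_winding_def)

text \<open>For \<open>k = 0\<close> the set contains infinity and is the complement of a compact
  set \<open>C\<close>: the loop together with the points of non-zero winding number. For other
  \<open>k\<close> it is an open set of the plane.\<close>

lemma openin_ext_winding_levelset:
  assumes "path \<gamma>" "pathfinish \<gamma> = pathstart \<gamma>"
  shows "openin extended_plane {x. x \<notin> Some ` path_image \<gamma> \<and> ext_winding \<gamma> x = k}"
proof (cases "k = 0")
  case False
  have "{x. x \<notin> Some ` path_image \<gamma> \<and> ext_winding \<gamma> x = k} =
      Some ` {z. z \<notin> path_image \<gamma> \<and> winding_number \<gamma> z = k}" (is "_ = Some ` ?U")
    using False by (auto simp: ext_winding_def image_iff split: option.splits)
  moreover have "open ?U" by (rule open_winding_number_levelsets[OF assms])
  ultimately show ?thesis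
    by (metis extended_plane_def open_openin openin_Alexandroff_compactification_image_Some)
next
  case True
  define C where "C = path_image \<gamma> \<union> {z. winding_number \<gamma> z \<noteq> 0}"
  have "closed C"
  proof -
    have "- C = {z. z \<notin> path_image \<gamma> \<and> winding_number \<gamma> z = 0}" by (auto simp: C_def)
    then show ?thesis using open_winding_number_levelsets[OF assms] by (simp add: closed_def)
  qed
  moreover have "bounded C"
    using bounded_winding_number_nz[OF assms] bounded_path_image[OF assms(1)] by (simp add: C_def)
  ultimately have "compact C" by (simp add: compact_eq_bounded_closed)
  moreover have "{x. x \<notin> Some ` path_image \<gamma> \<and> ext_winding \<gamma> x = k} = insert None (Some ` (UNIV - C))"
  proof (rule set_eqI)
    fix x show "x \<in> {x. x \<notin> Some ` path_image \<gamma> \<and> ext_winding \<gamma> x = k} \<longleftrightarrow>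
        x \<in> insert None (Some ` (UNIV - C))"
      using True by (cases x) (auto simp: C_def)
  qed
  moreover have "openin extended_plane (insert None (Some ` (UNIV - C)))"
    unfolding extended_plane_def openin_Alexandroff_compactification
    using \<open>closed C\<close> \<open>compact C\<close> by (intro disjI2 exI[of _ C]) simp
  ultimately show ?thesis by simp
qed

text \<open>Otherwise the level set of \<open>x\<close> and the union of all other level sets, which
  are open, would disconnect \<open>C\<close>.\<close>

lemma ext_winding_constant:
  assumes \<gamma>: "path \<gamma>" "pathfinish \<gamma> = pathstart \<gamma>"
    and C: "connectedin extended_plane C" "C \<inter> Some ` path_image \<gamma> = {}" and "x \<in> C" "y \<in> C"
  shows "ext_winding \<gamma> x = ext_winding \<gamma> y"
proof (rule ccontr)
  assume neq: "ext_winding \<gamma> x \<noteq> ext_winding \<gamma> y"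
  define L where "L k = {x. x \<notin> Some ` path_image \<gamma> \<and> ext_winding \<gamma> x = k}" for k
  have L: "openin extended_plane (L k)" for k
    unfolding L_def by (rule openin_ext_winding_levelset[OF \<gamma>])
  define E1 where "E1 = L (ext_winding \<gamma> x)"
  define E2 where "E2 = (\<Union>k\<in>-{ext_winding \<gamma> x}. L k)"
  have "openin extended_plane E1" "openin extended_plane E2"
    using L by (auto simp: E1_def E2_def)
  moreover have "C \<subseteq> E1 \<union> E2" "E1 \<inter> E2 \<inter> C = {}"
    using C(2) by (auto simp: E1_def E2_def L_def)
  moreover have "x \<in> E1 \<inter> C" "y \<in> E2 \<inter> C"
    using C(2) neq assms(5,6) by (auto simp: E1_def E2_def L_def)
  ultimately show False using C(1) unfolding connectedin by blast
qed

text \<open>Finitely many points detect the homology class of a loop in \<Omega>: \<open>A\<close>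
  takes one point from each component of the extended complement that avoids infinity. On the
  component of infinity all winding numbers vanish.\<close>

lemma finitely_connected_winding_representatives:
  assumes "finitely_connected_domain \<Omega>"
  obtains A where "finite A" "A \<subseteq> - \<Omega>"
    and "\<And>b p q. \<lbrakk>b \<notin> \<Omega>; path p; pathfinish p = pathstart p; path_image p \<subseteq> \<Omega>;
      path q; pathfinish q = pathstart q; path_image q \<subseteq> \<Omega>;
      \<And>a. a \<in> A \<Longrightarrow> winding_number p a = winding_number q a\<rbrakk>
      \<Longrightarrow> winding_number p b = winding_number q b"
proof -
  let ?X = "subtopology extended_plane (extended_complement \<Omega>)"
  define \<C> where "\<C> = {C \<in> connected_components_of ?X. None \<notin> C}"
  define rep where "rep C = (SOME z. Some z \<in> C)" for C :: "complex option set"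
  have topX: "topspace ?X = extended_complement \<Omega>"
    by (auto simp: extended_complement_def)
  have rep: "Some (rep C) \<in> C" if "C \<in> \<C>" for C
  proof -
    have "C \<noteq> {}" using that nonempty_connected_components_of by (auto simp: \<C>_def)
    then obtain x where "x \<in> C" by blast
    have "None \<notin> C" using that by (simp add: \<C>_def)
    with \<open>x \<in> C\<close> obtain z where "Some z \<in> C" by (cases x) auto
    then show ?thesis unfolding rep_def by (rule someI)
  qed
  have C_sub: "C \<subseteq> extended_complement \<Omega>" if "C \<in> connected_components_of ?X" for C
    using connected_components_of_subset[OF that] topX by simp
  show ?thesis
  proof (rule that[of "rep ` \<C>"])
    show "finite (rep ` \<C>)"
      using assms by (simp add: \<C>_def finitely_connected_domain_def)
    show "rep ` \<C> \<subseteq> - \<Omega>"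
    proof
      fix a assume "a \<in> rep ` \<C>"
      then obtain C where "C \<in> \<C>" "a = rep C" by auto
      then have "Some a \<in> extended_complement \<Omega>" using rep C_sub by (auto simp: \<C>_def)
      then show "a \<in> - \<Omega>" by (auto simp: extended_complement_altdef)
    qed
    fix b p q
    assume b: "b \<notin> \<Omega>"
      and p: "path p" "pathfinish p = pathstart p" "path_image p \<subseteq> \<Omega>"
      and q: "path q" "pathfinish q = pathstart q" "path_image q \<subseteq> \<Omega>"
      and eq: "\<And>a. a \<in> rep ` \<C> \<Longrightarrow> winding_number p a = winding_number q a"
    have "Some b \<in> topspace ?X" using b topX by (auto simp: extended_complement_altdef)
    then obtain C where C: "C \<in> connected_components_of ?X" "Some b \<in> C"
      using Union_connected_components_of[of ?X] by blast
    have con: "connectedin extended_plane C"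
      using connectedin_connected_components_of[OF C(1)] by (simp add: connectedin_subtopology)
    have disj: "C \<inter> Some ` path_image \<gamma> = {}" if "path_image \<gamma> \<subseteq> \<Omega>" for \<gamma> :: "real \<Rightarrow> complex"
      using C_sub[OF C(1)] that by (auto simp: extended_complement_altdef)
    \<comment> \<open>In the component of \<open>b\<close>, both winding numbers are known to agree
      at infinity if it belongs to the component, and otherwise at the chosen
      representative.\<close>
    obtain x where x: "x \<in> C" "ext_winding p x = ext_winding q x"
    proof (cases "None \<in> C")
      case True
      then show ?thesis using that[of None] by simp
    next
      case False
      then have "C \<in> \<C>" using C(1) by (simp add: \<C>_def)
      then show ?thesis using that[of "Some (rep C)"] rep eq by simp
    qed
    have "ext_winding p (Some b) = ext_winding q (Some b)"
      using ext_winding_constant[OF p(1,2) con disj[OF p(3)] C(2) x(1)]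
        ext_winding_constant[OF q(1,2) con disj[OF q(3)] C(2) x(1)] x(2) by simp
    then show "winding_number p b = winding_number q b" by simp
  qed
qed

section \<open>Contour integrals and logarithmic derivatives\<close>

text \<open>A path \<open>c\<close> in \<open>S\<close> joins the base points. The loop
  \<open>p\<close>, \<open>c\<close>, reversed \<open>q\<close>, reversed \<open>c\<close> has
  winding number 0 about every point outside \<open>S\<close>, so the global Cauchy theorem applies,
  and the two integrals along \<open>c\<close> cancel.\<close>

lemma contour_integral_homologous_eq:
  assumes S: "open S" "connected S" and f: "f holomorphic_on S"
    and p: "valid_path p" "pathfinish p = pathstart p" "path_image p \<subseteq> S"
    and q: "valid_path q" "pathfinish q = pathstart q" "path_image q \<subseteq> S"
    and eq: "\<And>z. z \<notin> S \<Longrightarrow> winding_number p z = winding_number q z"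
  shows "contour_integral p f = contour_integral q f"
proof -
  have "pathstart p \<in> S" "pathstart q \<in> S" using p q by auto
  then obtain c where "polynomial_function c" and c: "path_image c \<subseteq> S" "pathstart c = pathstart p"
      "pathfinish c = pathstart q"
    using connected_open_polynomial_connected[OF S] by blast
  then have vc: "valid_path c" by (simp add: valid_path_polynomial_function)
  define r where "r = p +++ c +++ reversepath q +++ reversepath c"
  have r: "valid_path r" "pathfinish r = pathstart r"
    unfolding r_def using p q c vc by (auto intro!: valid_path_join)
  have "path_image r \<subseteq> S"
    using p q c by (auto simp: r_def path_image_join)
  moreover have "winding_number r z = 0" if "z \<notin> S" for z
  proof -
    have "z \<notin> path_image p" "z \<notin> path_image q" "z \<notin> path_image c" using that p q c by auto
    then show ?thesis
      using p q c vc eq[OF that] unfolding r_def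
      by (simp add: winding_number_join winding_number_reversepath valid_path_imp_path
          path_image_join)
  qed
  ultimately have "(f has_contour_integral 0) r"
    by (intro Cauchy_theorem_global[OF S(1) f r]) auto
  then have "contour_integral r f = 0" by (rule contour_integral_unique)
  moreover have "f contour_integrable_on p" "f contour_integrable_on q" "f contour_integrable_on c"
    using contour_integrable_holomorphic_simple[OF f S(1)] p q c vc by auto
  ultimately show ?thesis
    using p q c vc unfolding r_def
    by (simp add: contour_integral_reversepath contour_integrable_reversepath)
qed

text \<open>A branch of the logarithm of an injective function takes no two values that differ by
  \<open>2\<pi>i\<close>, so its image contains no disc of radius \<open>4 > \<pi>\<close>, and Bloch's theorem applies to it.\<close>

lemma norm_log_deriv_injective_le:
  assumes h: "h holomorphic_on ball z r" "inj_on h (ball z r)" and "0 < r"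
    and b: "b \<notin> h ` ball z r"
  shows "norm (deriv h z / (h z - b)) \<le> 48 / r"
proof (rule ccontr)
  assume less: "\<not> norm (deriv h z / (h z - b)) \<le> 48 / r"
  have z: "z \<in> ball z r" using \<open>0 < r\<close> by simp
  have "(\<lambda>w. h w - b) holomorphic_on ball z r" "\<And>w. w \<in> ball z r \<Longrightarrow> h w - b \<noteq> 0"
    using h b by (auto intro!: holomorphic_intros)
  then obtain g where g: "g holomorphic_on ball z r" "\<And>w. w \<in> ball z r \<Longrightarrow> exp (g w) = h w - b"
    using holomorphic_logarithm_exists[OF convex_ball open_ball _ _ z] by blast
  have dg: "(g has_field_derivative deriv g z) (at z)"
    using g(1) z holomorphic_derivI open_ball by blast
  have "((\<lambda>w. exp (g w)) has_field_derivative exp (g z) * deriv g z) (at z)"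
    by (rule DERIV_fun_exp[OF dg])
  moreover have "((\<lambda>w. exp (g w)) has_field_derivative deriv h z) (at z)"
  proof (rule has_field_derivative_transform_within_open[OF _ open_ball z])
    have "(h has_field_derivative deriv h z) (at z)"
      using h(1) z holomorphic_derivI open_ball by blast
    then show "((\<lambda>w. h w - b) has_field_derivative deriv h z) (at z)"
      by (auto intro!: derivative_eq_intros)
  qed (use g in auto)
  ultimately have "exp (g z) * deriv g z = deriv h z" by (rule DERIV_unique)
  then have "deriv h z / (h z - b) = deriv g z" using g(2)[OF z] by (metis exp_not_eq_zero nonzero_mult_div_cancel_left)
  then have "48 / r < norm (deriv g z)" using less by simp
  \<comment> \<open>Bloch's theorem gives discs of radius up to
    \<open>r * norm (deriv g z) / 12\<close>, whence the constant 48 = 4 * 12.\<close>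
  then have "4 \<le> r * norm (deriv g z) / 12" using \<open>0 < r\<close> by (simp add: field_simps)
  then obtain c where c: "ball c 4 \<subseteq> g ` ball z r" using Bloch[OF g(1) \<open>0 < r\<close>] by blast
  have "c - \<i> * pi \<in> ball c 4" "c + \<i> * pi \<in> ball c 4"
    using pi_less_4 by (auto simp: dist_norm norm_mult)
  then obtain u v where uv: "u \<in> ball z r" "v \<in> ball z r" "g u = c - \<i> * pi" "g v = c + \<i> * pi"
    using c by (metis image_iff subsetD)
  have "exp (g v) = exp (g u)"
    unfolding exp_eq uv(3,4) by (intro exI[of _ 1]) (simp add: algebra_simps)
  then have "h u = h v" using g(2)[OF uv(1)] g(2)[OF uv(2)] by simp
  then have "u = v" using h(2) uv by (meson inj_onD)
  then have "c - \<i> * pi = c + \<i> * pi" using uv(3,4) by simp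
  then show False by (simp add: complex_eq_iff)
qed

text \<open>The integral is bounded through an open neighbourhood \<open>U\<close> of the path.
  Enclosing \<open>U\<close> in a compact \<open>K\<close> inside \<open>S\<close> makes the bound
  one in the topology of uniform convergence on compact sets.\<close>

lemma contour_integral_bound_compact:
  assumes "open S" "valid_path g" "path_image g \<subseteq> S"
  shows "\<exists>K L. compact K \<and> K \<subseteq> S \<and> 0 < L \<and>
    (\<forall>f B. f holomorphic_on S \<longrightarrow> (\<forall>z\<in>K. norm (f z) \<le> B) \<longrightarrow>
       norm (contour_integral g f) \<le> L * B)"
proof -
  have cpt: "compact (path_image g)" using assms(2) by (simp add: compact_valid_path_image)
  obtain e where e: "e > 0" "(\<Union>x\<in>path_image g. cball x e) \<subseteq> S"
    using compact_subset_open_imp_cball_epsilon_subset[OF cpt assms(1,3)] by blast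
  define U where "U = (\<Union>x\<in>path_image g. ball x e)"
  define K where "K = (\<Union>x\<in>path_image g. cball x e)"
  have UK: "U \<subseteq> K" by (auto simp: U_def K_def)
  have "open U" "path_image g \<subseteq> U" using e by (auto simp: U_def)
  then obtain L where L: "0 < L" "\<forall>f B. f holomorphic_on U \<and> (\<forall>z\<in>U. norm (f z) \<le> B) \<longrightarrow>
      norm (contour_integral g f) \<le> L * B"
    using contour_integral_bound_exists[OF _ assms(2)] by blast
  have "compact K" unfolding K_def by (rule compact_minkowski_sum_cball[OF cpt])
  moreover have "K \<subseteq> S" using e by (simp add: K_def)
  moreover have "norm (contour_integral g f) \<le> L * B"
    if "f holomorphic_on S" "\<forall>z\<in>K. norm (f z) \<le> B" for f B
  proof -
    have "f holomorphic_on U" using that(1) UK \<open>K \<subseteq> S\<close> by (meson holomorphic_on_subset)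
    then show ?thesis using L(2) that(2) UK by blast
  qed
  ultimately show ?thesis using L(1) by blast
qed

text \<open>Unite the compact sets and take the maximum of the constants; \<open>0 \<le> B\<close>
  makes the bound monotone in the constant.\<close>

lemma uniform_contour_integral_bound_compact:
  fixes P :: "(real \<Rightarrow> complex) set"
  assumes "finite P" "open S" "\<And>g. g \<in> P \<Longrightarrow> valid_path g \<and> path_image g \<subseteq> S"
  shows "\<exists>K L. compact K \<and> K \<subseteq> S \<and> 0 < L \<and>
    (\<forall>g\<in>P. \<forall>f B. f holomorphic_on S \<longrightarrow> (\<forall>z\<in>K. norm (f z) \<le> B) \<longrightarrow> 0 \<le> B \<longrightarrow>
       norm (contour_integral g f) \<le> L * B)"
  using assms(1,3)
proof (induction P rule: finite_induct)
  case empty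
  show ?case by (intro exI[of _ "{}"] exI[of _ 1]) simp
next
  case (insert p P)
  obtain K L where K: "compact K" "K \<subseteq> S" "0 < L"
    and L: "\<forall>g\<in>P. \<forall>f B. f holomorphic_on S \<longrightarrow> (\<forall>z\<in>K. norm (f z) \<le> B) \<longrightarrow> 0 \<le> B \<longrightarrow>
       norm (contour_integral g f) \<le> L * B"
    using insert.IH insert.prems by blast
  have p: "valid_path p" "path_image p \<subseteq> S" using insert.prems[of p] by auto
  obtain K' L' where K': "compact K'" "K' \<subseteq> S" "0 < L'"
    and L': "\<forall>f B. f holomorphic_on S \<longrightarrow> (\<forall>z\<in>K'. norm (f z) \<le> B) \<longrightarrow>
       norm (contour_integral p f) \<le> L' * B"
    using contour_integral_bound_compact[OF assms(2) p] by blast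
  have "norm (contour_integral g f) \<le> max L L' * B"
    if "g \<in> insert p P" "f holomorphic_on S" "\<forall>z\<in>K \<union> K'. norm (f z) \<le> B" "0 \<le> B" for g f B
  proof -
    have "norm (contour_integral g f) \<le> L * B \<or> norm (contour_integral g f) \<le> L' * B"
    proof (cases "g = p")
      case True
      then show ?thesis using L'[rule_format, OF that(2), of B] that(3) by simp
    next
      case False
      then have "g \<in> P" using that(1) by simp
      then show ?thesis using L[rule_format, OF _ that(2), of g B] that(3,4) by simp
    qed
    moreover have "L * B \<le> max L L' * B" "L' * B \<le> max L L' * B"
      using that(4) by (auto intro: mult_right_mono)
    ultimately show ?thesis by linarith
  qed
  moreover have "compact (K \<union> K')" "K \<union> K' \<subseteq> S" "0 < max L L'" using K K' by auto
  ultimately show ?case by blast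
qed

section \<open>Basic neighbourhoods in H(\<Omega>) and iterates of self-maps\<close>

text \<open>The distance between \<open>g\<close> and \<open>f\<close> attains its maximum on a
  non-empty compact \<open>K\<close>, and this maximum is below \<open>e\<close>; the remaining
  margin serves as radius around \<open>g\<close>.\<close>

lemma openin_hol_nbhd:
  assumes "compact K" "K \<subseteq> \<Omega>" "f \<in> hol_fun \<Omega>"
  shows "openin (hol_space \<Omega>) (hol_nbhd \<Omega> f K e)"
  unfolding openin_hol_space hol_open_def
proof (intro conjI ballI)
  fix g assume g: "g \<in> hol_nbhd \<Omega> f K e"
  show "\<exists>K' e'. compact K' \<and> K' \<subseteq> \<Omega> \<and> 0 < e' \<and> hol_nbhd \<Omega> g K' e' \<subseteq> hol_nbhd \<Omega> f K e"
  proof (cases "K = {}")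
    case True
    then show ?thesis by (intro exI[of _ "{}"] exI[of _ 1]) (auto simp: hol_nbhd_def)
  next
    case False
    have "continuous_on K f" "continuous_on K g"
      using assms g by (auto simp: hol_fun_def hol_nbhd_def
          intro: holomorphic_on_imp_continuous_on holomorphic_on_subset)
    then have "continuous_on K (\<lambda>z. dist (g z) (f z))" by (intro continuous_intros)
    then obtain m where m: "m \<in> K" "\<And>z. z \<in> K \<Longrightarrow> dist (g z) (f z) \<le> dist (g m) (f m)"
      using continuous_attains_sup[OF assms(1) False] by blast
    have "hol_nbhd \<Omega> g K (e - dist (g m) (f m)) \<subseteq> hol_nbhd \<Omega> f K e"
    proof
      fix h assume h: "h \<in> hol_nbhd \<Omega> g K (e - dist (g m) (f m))"
      have "dist (h z) (f z) < e" if "z \<in> K" for z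
      proof -
        have "dist (h z) (g z) < e - dist (g m) (f m)" using h that by (auto simp: hol_nbhd_def)
        with m(2)[OF that] dist_triangle[of "h z" "f z" "g z"] show ?thesis by linarith
      qed
      then show "h \<in> hol_nbhd \<Omega> f K e" using h by (auto simp: hol_nbhd_def)
    qed
    moreover have "0 < e - dist (g m) (f m)" using g m(1) by (auto simp: hol_nbhd_def)
    ultimately show ?thesis using assms by blast
  qed
qed (auto simp: hol_nbhd_def)

lemma funpow_image_subset:
  assumes "\<phi> ` \<Omega> \<subseteq> \<Omega>"
  shows "(\<phi> ^^ n) ` \<Omega> \<subseteq> \<Omega>"
  using assms by (induction n) auto

lemma holomorphic_on_funpow:
  assumes "\<phi> holomorphic_on \<Omega>" "\<phi> ` \<Omega> \<subseteq> \<Omega>"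
  shows "(\<phi> ^^ n) holomorphic_on \<Omega>"
proof (induction n)
  case (Suc n)
  have "(\<phi> \<circ> (\<phi> ^^ n)) holomorphic_on \<Omega>"
    using Suc assms(1) funpow_image_subset[OF assms(2)] by (rule holomorphic_on_compose_gen)
  then show ?case by (simp only: funpow.simps)
qed (simp add: holomorphic_on_id)

lemma inj_on_funpow_self_map:
  assumes "inj_on \<phi> \<Omega>" "\<phi> ` \<Omega> \<subseteq> \<Omega>"
  shows "inj_on (\<phi> ^^ n) \<Omega>"
proof (induction n)
  case (Suc n)
  have "inj_on \<phi> ((\<phi> ^^ n) ` \<Omega>)"
    using assms(1) funpow_image_subset[OF assms(2)] by (rule inj_on_subset)
  with Suc have "inj_on (\<phi> \<circ> (\<phi> ^^ n)) \<Omega>" by (rule comp_inj_on)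
  then show ?case by (simp only: funpow.simps)
qed simp

lemma comp_op_funpow:
  assumes "\<phi> ` \<Omega> \<subseteq> \<Omega>" "z \<in> \<Omega>"
  shows "((comp_op \<Omega> \<phi> ^^ n) f) z = f ((\<phi> ^^ n) z)"
  using assms(2)
proof (induction n arbitrary: z)
  case (Suc n)
  then have "\<phi> z \<in> \<Omega>" using assms(1) by auto
  have "(comp_op \<Omega> \<phi> ^^ Suc n) f z = (comp_op \<Omega> \<phi> ^^ n) f (\<phi> z)"
    using Suc.prems by (simp add: comp_op_def)
  also have "\<dots> = f ((\<phi> ^^ Suc n) z)" using Suc.IH[OF \<open>\<phi> z \<in> \<Omega>\<close>] by (simp only: funpow_Suc_right o_apply)
  finally show ?case .
qed simp

section \<open>Approximation properties that follow from transitivity\<close>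

text \<open>Disjoint transitivity is applied to neighbourhoods of \<open>f0\<close> and
  \<open>f1\<close>, with all of H(\<Omega>) as the open set for each index from 2 on.\<close>

lemma disjoint_transitive_approx:
  assumes dt: "disjoint_topologically_transitive (hol_space \<Omega>) N (\<lambda>i. comp_op \<Omega> (\<phi> i))"
    and "N \<ge> 1" "\<phi> 1 ` \<Omega> \<subseteq> \<Omega>" "f0 holomorphic_on \<Omega>" "f1 holomorphic_on \<Omega>"
    and K: "compact K" "K \<subseteq> \<Omega>" and "e > 0"
  obtains n f where "n \<ge> 1" "f holomorphic_on \<Omega>"
    "\<And>z. z \<in> K \<Longrightarrow> dist (f z) (f0 z) < e" "\<And>z. z \<in> K \<Longrightarrow> dist (f ((\<phi> 1 ^^ n) z)) (f1 z) < e"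
proof -
  have R: "restrict g \<Omega> \<in> hol_fun \<Omega>" if "g holomorphic_on \<Omega>" for g
    using holomorphic_transform[OF that, of "restrict g \<Omega>"] by (auto simp: hol_fun_def)
  define U where "U i = (if i = 0 then hol_nbhd \<Omega> (restrict f0 \<Omega>) K e
    else if i = 1 then hol_nbhd \<Omega> (restrict f1 \<Omega>) K e else hol_fun \<Omega>)" for i :: nat
  have "openin (hol_space \<Omega>) (U i) \<and> U i \<noteq> {}" for i
  proof
    show "openin (hol_space \<Omega>) (U i)"
      using openin_hol_nbhd[OF K] R assms(4,5) openin_topspace[of "hol_space \<Omega>"]
      by (auto simp: U_def)
    have "restrict f0 \<Omega> \<in> hol_nbhd \<Omega> (restrict f0 \<Omega>) K e" "restrict f1 \<Omega> \<in> hol_nbhd \<Omega> (restrict f1 \<Omega>) K e"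
      using R assms(4,5) \<open>e > 0\<close> by (auto simp: hol_nbhd_def)
    then show "U i \<noteq> {}"
      using R[OF assms(4)] by (auto simp: U_def)
  qed
  then obtain n where n: "n \<ge> 1"
    "U 0 \<inter> (\<Inter>i\<in>{1..N}. {x \<in> topspace (hol_space \<Omega>). (comp_op \<Omega> (\<phi> i) ^^ n) x \<in> U i}) \<noteq> {}"
    using dt unfolding disjoint_topologically_transitive_def by blast
  then obtain f where f: "f \<in> U 0" "(comp_op \<Omega> (\<phi> 1) ^^ n) f \<in> U 1"
    using \<open>N \<ge> 1\<close> by fastforce
  show ?thesis
  proof (rule that[OF n(1)])
    show "f holomorphic_on \<Omega>" using f(1) by (simp add: U_def hol_nbhd_def hol_fun_def)
    show "dist (f z) (f0 z) < e" if "z \<in> K" for z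
    proof -
      have "z \<in> \<Omega>" using that K(2) by auto
      then show ?thesis using f(1) that by (auto simp: U_def hol_nbhd_def)
    qed
    show "dist (f ((\<phi> 1 ^^ n) z)) (f1 z) < e" if "z \<in> K" for z
    proof -
      have "z \<in> \<Omega>" using that K(2) by auto
      then show ?thesis
        using f(2) that comp_op_funpow[OF assms(3)] by (auto simp: U_def hol_nbhd_def)
    qed
  qed
qed

text \<open>Transitivity approximates by some \<open>f\<close> composed with an iterate whose
  exponent \<open>m\<close> is not prescribed. Since \<open>m \<ge> 1\<close>, this is a function
  composed with \<open>\<phi> 1\<close> itself, so one composition operator has dense range;
  induction passes to every power.\<close>

lemma disjoint_transitive_dense_range:
  assumes dt: "disjoint_topologically_transitive (hol_space \<Omega>) N (\<lambda>i. comp_op \<Omega> (\<phi> i))"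
    and "N \<ge> 1" and \<phi>: "\<phi> 1 holomorphic_on \<Omega>" "\<phi> 1 ` \<Omega> \<subseteq> \<Omega>"
    and "g holomorphic_on \<Omega>" "compact K" "K \<subseteq> \<Omega>" "e > 0"
  shows "\<exists>f. f holomorphic_on \<Omega> \<and> (\<forall>z\<in>K. dist (f ((\<phi> 1 ^^ n) z)) (g z) < e)"
  using assms(5-)
proof (induction n arbitrary: g K e)
  case 0
  then show ?case by (intro exI[of _ g]) simp
next
  case (Suc n)
  have "e / 2 > 0" using Suc.prems by simp
  obtain m f where f: "m \<ge> 1" "f holomorphic_on \<Omega>" "\<And>z. z \<in> K \<Longrightarrow> dist (f z) (g z) < e / 2"
    "\<And>z. z \<in> K \<Longrightarrow> dist (f ((\<phi> 1 ^^ m) z)) (g z) < e / 2"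
    by (rule disjoint_transitive_approx[OF dt \<open>N \<ge> 1\<close> \<phi>(2) Suc.prems(1,1,2,3) \<open>e / 2 > 0\<close>])
      (rule that)
  \<comment> \<open>One factor of the iterate is split off, so that \<open>f'\<close> after
    \<open>\<phi> 1\<close> is \<open>f\<close> after the full iterate; the induction hypothesis
    then approximates \<open>f'\<close> on the image of \<open>K\<close>.\<close>
  define f' where "f' = f \<circ> (\<phi> 1 ^^ (m - 1))"
  have f': "f' holomorphic_on \<Omega>"
    unfolding f'_def using holomorphic_on_funpow[OF \<phi>] f(2) funpow_image_subset[OF \<phi>(2)]
    by (rule holomorphic_on_compose_gen)
  have f'_eq: "f' (\<phi> 1 z) = f ((\<phi> 1 ^^ m) z)" for z
  proof -
    have "(\<phi> 1 ^^ m) z = (\<phi> 1 ^^ Suc (m - 1)) z" using f(1) by simp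
    then show ?thesis by (simp only: f'_def funpow_Suc_right o_apply)
  qed
  have "compact (\<phi> 1 ` K)"
    using Suc.prems \<phi>(1) by (meson compact_continuous_image holomorphic_on_imp_continuous_on holomorphic_on_subset)
  moreover have "\<phi> 1 ` K \<subseteq> \<Omega>" using Suc.prems \<phi>(2) by auto
  ultimately have "\<exists>h. h holomorphic_on \<Omega> \<and>
      (\<forall>z\<in>\<phi> 1 ` K. dist (h ((\<phi> 1 ^^ n) z)) (f' z) < e / 2)"
    by (rule Suc.IH[OF f' _ _ \<open>e / 2 > 0\<close>])
  then obtain h where h: "h holomorphic_on \<Omega>"
    "\<And>z. z \<in> K \<Longrightarrow> dist (h ((\<phi> 1 ^^ n) (\<phi> 1 z))) (f' (\<phi> 1 z)) < e / 2"
    by auto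
  have "dist (h ((\<phi> 1 ^^ Suc n) z)) (g z) < e" if "z \<in> K" for z
  proof -
    have "dist (f' (\<phi> 1 z)) (g z) < e / 2" unfolding f'_eq by (rule f(4)[OF that])
    with h(2)[OF that] have "dist (h ((\<phi> 1 ^^ n) (\<phi> 1 z))) (g z) < e"
      by (rule dist_triangle_half_l[OF _ dist_commute_lessI])
    then show ?thesis by (simp only: funpow_Suc_right o_apply)
  qed
  then show ?case using h(1) by blast
qed

section \<open>An iterate that makes the loop null-homologous\<close>

lemma contour_integral_compose_holomorphic:
  assumes "h holomorphic_on S" "open S" "valid_path \<gamma>" "path_image \<gamma> \<subseteq> S"
  shows "contour_integral (h \<circ> \<gamma>) f = contour_integral \<gamma> (\<lambda>z. f (h z) * deriv h z)"
  using contour_integral_comp_analyticW[of h S \<gamma> f] assms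
  by (simp add: analytic_on_open mult.commute)

text \<open>The integral of \<open>1 / (w - b)\<close> is split by \<open>1 = f + (1 - f)\<close>.
  The part with \<open>f\<close> is moved to one of finitely many loops fixed before
  \<open>f\<close> is chosen, where \<open>f\<close> is small; the part with \<open>1 - f\<close> is
  small along the image loop itself.\<close>

lemma transitive_iterate_null_homologous:
  assumes fin: "finitely_connected_domain \<Omega>"
    and \<phi>: "injective_hol_self_map \<Omega> (\<phi> 1)" and "N \<ge> 1"
    and dt: "disjoint_topologically_transitive (hol_space \<Omega>) N (\<lambda>i. comp_op \<Omega> (\<phi> i))"
    and \<gamma>: "valid_path \<gamma>" "pathfinish \<gamma> = pathstart \<gamma>" "path_image \<gamma> \<subseteq> \<Omega>"
  obtains n where "\<And>b. b \<notin> \<Omega> \<Longrightarrow> winding_number ((\<phi> 1 ^^ n) \<circ> \<gamma>) b = 0"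
proof -
  have \<Omega>: "open \<Omega>" "connected \<Omega>"
    using fin by (auto simp: finitely_connected_domain_def domain_in_plane_def)
  have \<phi>1: "\<phi> 1 holomorphic_on \<Omega>" "\<phi> 1 ` \<Omega> \<subseteq> \<Omega>" "inj_on (\<phi> 1) \<Omega>"
    using \<phi> by (auto simp: injective_hol_self_map_def)
  define h where "h n = \<phi> 1 ^^ n" for n
  have h: "h n holomorphic_on \<Omega>" "h n ` \<Omega> \<subseteq> \<Omega>" "inj_on (h n) \<Omega>" for n
    unfolding h_def using holomorphic_on_funpow[OF \<phi>1(1,2)] funpow_image_subset[OF \<phi>1(2)]
      inj_on_funpow_self_map[OF \<phi>1(3,2)] by simp_all
  define G where "G n = h n \<circ> \<gamma>" for n
  have G: "valid_path (G n)" "path_image (G n) \<subseteq> \<Omega>" "pathfinish (G n) = pathstart (G n)" for n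
    using valid_path_compose_holomorphic[OF \<gamma>(1) h(1) \<Omega>(1) \<gamma>(3)] h(2)[of n] \<gamma>
    by (auto simp: G_def path_image_compose pathfinish_compose pathstart_compose)
  have b_notin: "b \<notin> path_image (G n)" if "b \<notin> \<Omega>" for b n using G(2) that by blast

  obtain K0 L0 where K0: "compact K0" "K0 \<subseteq> \<Omega>" and L0: "0 < L0"
    "\<forall>f B. f holomorphic_on \<Omega> \<longrightarrow> (\<forall>z\<in>K0. norm (f z) \<le> B) \<longrightarrow>
       norm (contour_integral \<gamma> f) \<le> L0 * B"
    using contour_integral_bound_compact[OF \<Omega>(1) \<gamma>(1,3)] by blast
  obtain r where r: "r > 0" "(\<Union>z\<in>K0. cball z r) \<subseteq> \<Omega>"
    using compact_subset_open_imp_cball_epsilon_subset[OF K0(1) \<Omega>(1) K0(2)] by blast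
  \<comment> \<open>The discs of radius \<open>r\<close> about points of \<open>K0\<close> lie in
    \<Omega>, so this bounds the logarithmic derivatives independently of \<open>n\<close> and
    \<open>b\<close>.\<close>
  define M where "M = 48 / r"
  define \<omega> where "\<omega> n b z = deriv (h n) z / (h n z - b)" for n b z
  have "M > 0" using r by (simp add: M_def)
  have \<omega>_bound: "norm (\<omega> n b z) \<le> M" if "z \<in> K0" "b \<notin> \<Omega>" for n b z
  proof -
    have sub: "ball z r \<subseteq> \<Omega>" using r(2) that(1) ball_subset_cball[of z r] by blast
    show ?thesis unfolding \<omega>_def M_def
    proof (rule norm_log_deriv_injective_le[OF _ _ r(1)])
      show "h n holomorphic_on ball z r" using h(1) sub by (rule holomorphic_on_subset)
      show "inj_on (h n) (ball z r)" using h(3) sub by (rule inj_on_subset)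
      show "b \<notin> h n ` ball z r" using h(2)[of n] sub that(2) by blast
    qed
  qed
  have \<omega>_hol: "\<omega> n b holomorphic_on \<Omega>" if "b \<notin> \<Omega>" for n b
  proof -
    have "h n z - b \<noteq> 0" if "z \<in> \<Omega>" for z using h(2)[of n] that \<open>b \<notin> \<Omega>\<close> by auto
    then have "(\<lambda>z. deriv (h n) z / (h n z - b)) holomorphic_on \<Omega>"
      using h(1) \<Omega>(1) by (intro holomorphic_intros) auto
    then show ?thesis by (simp add: \<omega>_def[abs_def])
  qed
  have comp_hol: "(\<lambda>z. F (h n z)) holomorphic_on \<Omega>" if "F holomorphic_on \<Omega>" for F n
    using holomorphic_on_compose_gen[OF h(1) that h(2), of n] by (simp add: o_def)
  \<comment> \<open>Substituting \<open>w = h n z\<close> moves the integral to the fixed loop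
    \<gamma>, where the uniform bounds are available.\<close>
  have int_G: "contour_integral (G n) (\<lambda>w. F w / (w - b)) = contour_integral \<gamma> (\<lambda>z. F (h n z) * \<omega> n b z)"
    for F n b
    using contour_integral_compose_holomorphic[OF h(1) \<Omega>(1) \<gamma>(1,3)] by (simp add: G_def \<omega>_def)
  have int_G_bound: "norm (contour_integral (G n) (\<lambda>w. F w / (w - b))) \<le> L0 * (B * M)"
    if "b \<notin> \<Omega>" "F holomorphic_on \<Omega>" "\<And>z. z \<in> K0 \<Longrightarrow> norm (F (h n z)) \<le> B" "0 \<le> B" for F b n B
    unfolding int_G
  proof (rule L0(2)[rule_format])
    show "(\<lambda>z. F (h n z) * \<omega> n b z) holomorphic_on \<Omega>"
      using comp_hol[OF that(2)] \<omega>_hol[OF that(1)] by (rule holomorphic_on_mult)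
    show "norm (F (h n z) * \<omega> n b z) \<le> B * M" if "z \<in> K0" for z
      unfolding norm_mult using that \<open>\<And>z. z \<in> K0 \<Longrightarrow> norm (F (h n z)) \<le> B\<close> \<omega>_bound \<open>b \<notin> \<Omega>\<close> \<open>0 \<le> B\<close>
      by (intro mult_mono) auto
  qed
  have wn: "2 * pi * norm (winding_number (G n) b) = norm (contour_integral (G n) (\<lambda>w. 1 / (w - b)))"
    if "b \<notin> \<Omega>" for n b
    using winding_number_valid_path[OF G(1) b_notin[OF that]] by (simp add: norm_mult norm_divide)

  obtain A where A: "finite A" "A \<subseteq> - \<Omega>"
    "\<And>b p q. \<lbrakk>b \<notin> \<Omega>; path p; pathfinish p = pathstart p; path_image p \<subseteq> \<Omega>;
      path q; pathfinish q = pathstart q; path_image q \<subseteq> \<Omega>;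
      \<And>a. a \<in> A \<Longrightarrow> winding_number p a = winding_number q a\<rbrakk>
      \<Longrightarrow> winding_number p b = winding_number q b"
    using finitely_connected_winding_representatives[OF fin] by blast
  \<comment> \<open>\<open>V n\<close> encodes the homology class of \<open>G n\<close>. Its entries
    are integers bounded by \<open>B\<close>, so only finitely many classes occur.\<close>
  define V where "V n = restrict (winding_number (G n)) A" for n
  define B where "B = \<lceil>L0 * M\<rceil>"
  have "V n \<in> A \<rightarrow>\<^sub>E of_int ` {- B..B}" for n
  proof
    fix a assume "a \<in> A"
    then have a: "a \<notin> \<Omega>" using A(2) by auto
    obtain k :: int where k: "winding_number (G n) a = of_int k"
      using integer_winding_number[OF valid_path_imp_path[OF G(1)] G(3) b_notin[OF a]] Ints_cases by metis
    have "1 * \<bar>real_of_int k\<bar> \<le> 2 * pi * \<bar>real_of_int k\<bar>"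
      using pi_ge_two by (intro mult_right_mono) auto
    also have "\<dots> = norm (contour_integral (G n) (\<lambda>w. 1 / (w - a)))"
      using wn[OF a, of n] k by simp
    also have "\<dots> \<le> L0 * M" using int_G_bound[OF a, of "\<lambda>_. 1" n 1] by simp
    finally have "\<bar>k\<bar> \<le> B" unfolding B_def by linarith
    then have "k \<in> {- B..B}" by auto
    then show "V n a \<in> of_int ` {- B..B}" using \<open>a \<in> A\<close> k by (simp add: V_def)
  qed (simp add: V_def)
  then have "range V \<subseteq> A \<rightarrow>\<^sub>E of_int ` {- B..B}" by blast
  then have "finite (range V)" by (rule finite_subset) (intro finite_PiE A(1) finite_imageI finite_atLeastAtMost_int)
  \<comment> \<open>\<open>I\<close> contains an index for every class that occurs.\<close>
  then obtain I where I: "finite I" "range V = V ` I"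
    using finite_subset_image[of "range V" V UNIV] by blast

  have GI: "finite (G ` I)" "\<And>g. g \<in> G ` I \<Longrightarrow> valid_path g \<and> path_image g \<subseteq> \<Omega>"
    using I(1) G(1,2) by auto
  obtain K1 L1 where K1: "compact K1" "K1 \<subseteq> \<Omega>" and L1: "0 < L1"
    "\<forall>g\<in>G ` I. \<forall>f B. f holomorphic_on \<Omega> \<longrightarrow> (\<forall>z\<in>K1. norm (f z) \<le> B) \<longrightarrow> 0 \<le> B \<longrightarrow>
       norm (contour_integral g f) \<le> L1 * B"
    using uniform_contour_integral_bound_compact[OF GI(1) \<Omega>(1) GI(2)] by blast
  obtain d where d: "d > 0" "(\<Union>z\<in>K1. cball z d) \<subseteq> \<Omega>"
    using compact_subset_open_imp_cball_epsilon_subset[OF K1(1) \<Omega>(1) K1(2)] by blast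
  \<comment> \<open>Chosen so that the two error terms \<open>L1 * (e / d)\<close> and
    \<open>L0 * (e * M)\<close> add up to exactly 1.\<close>
  define e where "e = 1 / (L1 / d + L0 * M)"
  have den: "L1 / d + L0 * M > 0"
    using L0(1) L1(1) d(1) \<open>M > 0\<close> by (simp add: add_pos_pos)
  then have e: "e > 0" by (simp add: e_def)
  have K: "compact (K0 \<union> K1)" "K0 \<union> K1 \<subseteq> \<Omega>" using K0 K1 by auto
  obtain n f where "n \<ge> 1" and f: "f holomorphic_on \<Omega>"
    "\<And>z. z \<in> K0 \<union> K1 \<Longrightarrow> dist (f z) 0 < e" "\<And>z. z \<in> K0 \<union> K1 \<Longrightarrow> dist (f (h n z)) 1 < e"
    by (rule disjoint_transitive_approx[OF dt \<open>N \<ge> 1\<close> \<phi>1(2) holomorphic_on_const holomorphic_on_const K e,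
          folded h_def]) (rule that)
  obtain i where i: "i \<in> I" "V i = V n" using I(2) by (metis imageE rangeI)
  have hom: "winding_number (G n) b = winding_number (G i) b" if "b \<notin> \<Omega>" for b
  proof (rule A(3)[OF that])
    show "winding_number (G n) a = winding_number (G i) a" if "a \<in> A" for a
      using i(2) that unfolding V_def by (metis restrict_apply')
  qed (use G in \<open>simp_all add: valid_path_imp_path\<close>)
  have "winding_number (G n) b = 0" if b: "b \<notin> \<Omega>" for b
  proof -
    have hol: "(\<lambda>w. F w / (w - b)) holomorphic_on \<Omega>" if "F holomorphic_on \<Omega>" for F
      using that b by (auto intro!: holomorphic_intros)
    \<comment> \<open>The homologous loop \<open>G i\<close> comes from the finite list, so
      \<open>K1\<close> controls its integral; there \<open>f\<close> is small and \<open>b\<close>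
      is at distance at least \<open>d\<close>.\<close>
    have "contour_integral (G n) (\<lambda>w. f w / (w - b)) = contour_integral (G i) (\<lambda>w. f w / (w - b))"
      using hol[OF f(1)] G hom by (intro contour_integral_homologous_eq[OF \<Omega>]) auto
    also have "norm \<dots> \<le> L1 * (e / d)"
    proof (rule L1(2)[rule_format])
      show "norm (f z / (z - b)) \<le> e / d" if "z \<in> K1" for z
      proof -
        have "b \<notin> cball z d" using d(2) that b by blast
        then have "d \<le> norm (z - b)" by (simp add: dist_norm)
        moreover have "norm (f z) \<le> e" using f(2)[of z] that by simp
        ultimately show ?thesis unfolding norm_divide using d(1) e by (intro frac_le) auto
      qed
    qed (use i hol f e d in auto)
    finally have 1: "norm (contour_integral (G n) (\<lambda>w. f w / (w - b))) \<le> L1 * (e / d)" .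
    have 2: "norm (contour_integral (G n) (\<lambda>w. (1 - f w) / (w - b))) \<le> L0 * (e * M)"
    proof (rule int_G_bound[OF b])
      show "norm (1 - f (h n z)) \<le> e" if "z \<in> K0" for z
        using f(3)[of z] that by (simp add: dist_norm norm_minus_commute)
    qed (use f e in \<open>auto intro!: holomorphic_intros\<close>)
    have int: "(\<lambda>w. f w / (w - b)) contour_integrable_on G n"
      "(\<lambda>w. (1 - f w) / (w - b)) contour_integrable_on G n"
      by (intro contour_integrable_holomorphic_simple[OF hol \<Omega>(1) G(1,2)] holomorphic_intros f(1))+
    have "contour_integral (G n) (\<lambda>w. 1 / (w - b)) =
        contour_integral (G n) (\<lambda>w. f w / (w - b) + (1 - f w) / (w - b))"
      by (simp flip: add_divide_distrib)
    also have "\<dots> = contour_integral (G n) (\<lambda>w. f w / (w - b))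
        + contour_integral (G n) (\<lambda>w. (1 - f w) / (w - b))"
      by (rule contour_integral_add[OF int])
    finally have "2 * pi * norm (winding_number (G n) b) \<le> L1 * (e / d) + L0 * (e * M)"
      using wn[OF b, of n] 1 2 norm_triangle_mono by metis
    also have "\<dots> = e * (L1 / d + L0 * M)" by (simp add: algebra_simps)
    also have "\<dots> = 1" using den by (simp add: e_def)
    finally have "2 * pi * norm (winding_number (G n) b) \<le> 1" .
    moreover have "2 * norm (winding_number (G n) b) \<le> pi * norm (winding_number (G n) b)"
      using pi_ge_two by (intro mult_right_mono) auto
    \<comment> \<open>The winding number is an integer, so modulus below 1 forces it to
      vanish.\<close>
    ultimately have "norm (winding_number (G n) b) < 1" by linarith
    moreover have "winding_number (G n) b \<in> \<int>"
      using integer_winding_number[OF valid_path_imp_path[OF G(1)] G(3) b_notin[OF b]] .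
    ultimately show ?thesis by (auto elim!: Ints_cases)
  qed
  then show ?thesis using that[of n] by (simp add: G_def h_def)
qed

section \<open>A non-trivial loop and the contradiction\<close>

text \<open>Without simple connectivity some holomorphic function has a non-zero integral along a
  loop in \<Omega>; by the global Cauchy theorem that loop winds around an omitted point.\<close>

lemma not_simply_connected_obtains_loop:
  assumes "domain_in_plane \<Omega>" "\<not> simply_connected_domain \<Omega>"
  obtains \<gamma> a where "valid_path \<gamma>" "pathfinish \<gamma> = pathstart \<gamma>" "path_image \<gamma> \<subseteq> \<Omega>"
    "a \<notin> \<Omega>" "winding_number \<gamma> a \<noteq> 0"
proof -
  have \<Omega>: "open \<Omega>" "connected \<Omega>" using assms(1) by (auto simp: domain_in_plane_def)
  have "\<not> simply_connected \<Omega>"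
    using assms simply_connected_imp_connectedin_extended_complement[OF \<Omega>(1)]
    by (auto simp: simply_connected_domain_def)
  then obtain \<gamma> f where \<gamma>: "valid_path \<gamma>" "path_image \<gamma> \<subseteq> \<Omega>" "pathfinish \<gamma> = pathstart \<gamma>"
    "f holomorphic_on \<Omega>" "\<not> (f has_contour_integral 0) \<gamma>"
    using simply_connected_eq_contour_integral_zero[OF \<Omega>(1)] \<Omega>(2) by blast
  then obtain a where "a \<notin> \<Omega>" "winding_number \<gamma> a \<noteq> 0"
    using Cauchy_theorem_global[OF \<Omega>(1) \<gamma>(4,1,3,2)] by blast
  then show ?thesis using that \<gamma> by blast
qed

theorem theorem2p3:
  fixes \<Omega> :: "complex set" and N :: nat
  assumes "finitely_connected_domain \<Omega>"
    and "\<not> simply_connected_domain \<Omega>"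
    and "N \<ge> 2"
  shows "\<not> (\<exists>\<phi> :: nat \<Rightarrow> complex \<Rightarrow> complex.
            (\<forall>i\<in>{1..N}. injective_hol_self_map \<Omega> (\<phi> i)) \<and>
            disjoint_topologically_transitive (hol_space \<Omega>) N (\<lambda>i. comp_op \<Omega> (\<phi> i)))"
proof
  assume "\<exists>\<phi> :: nat \<Rightarrow> complex \<Rightarrow> complex.
            (\<forall>i\<in>{1..N}. injective_hol_self_map \<Omega> (\<phi> i)) \<and>
            disjoint_topologically_transitive (hol_space \<Omega>) N (\<lambda>i. comp_op \<Omega> (\<phi> i))"
  then obtain \<phi> :: "nat \<Rightarrow> complex \<Rightarrow> complex" where
    all: "\<forall>i\<in>{1..N}. injective_hol_self_map \<Omega> (\<phi> i)" and
    dt: "disjoint_topologically_transitive (hol_space \<Omega>) N (\<lambda>i. comp_op \<Omega> (\<phi> i))"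
    by blast
  have N: "N \<ge> 1" using assms(3) by simp
  then have \<phi>: "injective_hol_self_map \<Omega> (\<phi> 1)" using all by auto
  then have \<phi>1: "\<phi> 1 holomorphic_on \<Omega>" "\<phi> 1 ` \<Omega> \<subseteq> \<Omega>" "inj_on (\<phi> 1) \<Omega>"
    by (auto simp: injective_hol_self_map_def)
  have dom: "domain_in_plane \<Omega>" and \<Omega>: "open \<Omega>"
    using assms(1) by (auto simp: finitely_connected_domain_def domain_in_plane_def)
  obtain \<gamma> a where \<gamma>: "valid_path \<gamma>" "pathfinish \<gamma> = pathstart \<gamma>" "path_image \<gamma> \<subseteq> \<Omega>"
    and a: "a \<notin> \<Omega>" "winding_number \<gamma> a \<noteq> 0"
    using not_simply_connected_obtains_loop[OF dom assms(2)] by blast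
  obtain n where n: "\<And>b. b \<notin> \<Omega> \<Longrightarrow> winding_number ((\<phi> 1 ^^ n) \<circ> \<gamma>) b = 0"
    using transitive_iterate_null_homologous[OF assms(1) \<phi> N dt \<gamma>] by blast
  define h where "h = \<phi> 1 ^^ n"
  have h: "h holomorphic_on \<Omega>" "h ` \<Omega> \<subseteq> \<Omega>" "inj_on h \<Omega>"
    unfolding h_def using holomorphic_on_funpow[OF \<phi>1(1,2)] funpow_image_subset[OF \<phi>1(2)]
      inj_on_funpow_self_map[OF \<phi>1(3,2)] by simp_all
  have h': "deriv h z \<noteq> 0" if "z \<in> \<Omega>" for z
    using holomorphic_injective_imp_regular[OF h(1) \<Omega> h(3) that] .
  have dh: "deriv h holomorphic_on \<Omega>" using h(1) \<Omega> by (rule holomorphic_deriv)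

  obtain K L where K: "compact K" "K \<subseteq> \<Omega>" and L: "0 < L"
    "\<forall>f B. f holomorphic_on \<Omega> \<longrightarrow> (\<forall>z\<in>K. norm (f z) \<le> B) \<longrightarrow>
       norm (contour_integral \<gamma> f) \<le> L * B"
    using contour_integral_bound_compact[OF \<Omega> \<gamma>(1,3)] by blast
  have "compact (deriv h ` K)"
    using K dh by (meson compact_continuous_image holomorphic_on_imp_continuous_on holomorphic_on_subset)
  then obtain D where D: "D > 0" "\<And>z. z \<in> K \<Longrightarrow> norm (deriv h z) \<le> D"
    using compact_imp_bounded bounded_pos by (metis imageI)
  define c where "c = norm (contour_integral \<gamma> (\<lambda>z. 1 / (z - a)))"
  have "a \<notin> path_image \<gamma>" using a \<gamma> by auto
  then have "c > 0"
    using winding_number_valid_path[OF \<gamma>(1), of a] a(2) by (auto simp: c_def)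
  \<comment> \<open>Makes the final error \<open>L * (e * D)\<close> equal to \<open>c / 2\<close>,
    where \<open>c\<close> is 2 pi times the modulus of the winding number of \<gamma> about
    \<open>a\<close>.\<close>
  define e where "e = c / (2 * L * D)"
  have e: "e > 0" using \<open>c > 0\<close> L D by (simp add: e_def)
  \<comment> \<open>Holomorphic because an injective \<open>h\<close> has no critical points; the
    factor \<open>deriv h z\<close> cancels the one produced by substitution.\<close>
  define g where "g z = 1 / (deriv h z * (z - a))" for z
  have g: "g holomorphic_on \<Omega>"
    unfolding g_def[abs_def] using h' a(1) h(1) \<Omega> by (intro holomorphic_intros) auto
  obtain f where f: "f holomorphic_on \<Omega>" "\<And>z. z \<in> K \<Longrightarrow> dist (f (h z)) (g z) < e"
    using disjoint_transitive_dense_range[OF dt N \<phi>1(1,2) g K e, of n] unfolding h_def by blast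
  have fh: "(\<lambda>z. f (h z)) holomorphic_on \<Omega>"
    using holomorphic_on_compose_gen[OF h(1) f(1) h(2)] by (simp add: o_def)
  \<comment> \<open>Null-homology of the image loop enters here; pulled back to \<gamma>, it
    annihilates \<open>f (h z) * deriv h z\<close>, which approximates \<open>1 / (z - a)\<close> on
    \<open>K\<close>.\<close>
  have "(f has_contour_integral 0) (h \<circ> \<gamma>)"
  proof (rule Cauchy_theorem_global[OF \<Omega> f(1)])
    show "valid_path (h \<circ> \<gamma>)" by (rule valid_path_compose_holomorphic[OF \<gamma>(1) h(1) \<Omega> \<gamma>(3)])
    show "path_image (h \<circ> \<gamma>) \<subseteq> \<Omega>" using h(2) \<gamma>(3) by (auto simp: path_image_compose)
  qed (use \<gamma> n in \<open>auto simp: h_def pathfinish_compose pathstart_compose\<close>)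
  then have 0: "contour_integral \<gamma> (\<lambda>z. f (h z) * deriv h z) = 0"
    using contour_integral_compose_holomorphic[OF h(1) \<Omega> \<gamma>(1,3), of f] contour_integral_unique by metis
  have int: "(\<lambda>z. g z * deriv h z) contour_integrable_on \<gamma>"
    "(\<lambda>z. f (h z) * deriv h z) contour_integrable_on \<gamma>"
    using contour_integrable_holomorphic_simple[OF _ \<Omega> \<gamma>(1,3)] g fh dh
    by (auto intro!: holomorphic_on_mult)
  have "contour_integral \<gamma> (\<lambda>z. 1 / (z - a)) = contour_integral \<gamma> (\<lambda>z. g z * deriv h z)"
    using h' \<gamma>(3) by (intro contour_integral_cong) (auto simp: g_def)
  also have "\<dots> = contour_integral \<gamma> (\<lambda>z. g z * deriv h z - f (h z) * deriv h z)"
    using contour_integral_diff[OF int] 0 by simp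
  also have "norm \<dots> \<le> L * (e * D)"
  proof (rule L(2)[rule_format])
    show "(\<lambda>z. g z * deriv h z - f (h z) * deriv h z) holomorphic_on \<Omega>"
      using g fh h(1) \<Omega> by (intro holomorphic_intros)
    show "norm (g z * deriv h z - f (h z) * deriv h z) \<le> e * D" if "z \<in> K" for z
    proof -
      have "norm (g z - f (h z)) \<le> e" using f(2)[OF that] by (simp add: dist_norm norm_minus_commute)
      then have "norm (g z - f (h z)) * norm (deriv h z) \<le> e * D"
        using D(2)[OF that] e by (intro mult_mono) auto
      then show ?thesis by (simp add: norm_mult flip: left_diff_distrib)
    qed
  qed
  finally have "c \<le> L * (e * D)" by (simp add: c_def)
  also have "\<dots> = c / 2" using L D by (simp add: e_def)
  finally show False using \<open>c > 0\<close> by simp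
qed

end
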